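(* Let $s\ge1$ be an integer and let $\hat\psi_{2s}(y)=\sum_{i=0}^{2s}\frac{y^i}{i!}$ be the Taylor polynomial of $\exp$ at $0$ of order $2s$. Then $\hat\psi_{2s}(y)\ge0$ for all $y\in\mathbb R$, and $\hat\psi_{2s}$ can be written as a sum of squares of real polynomials. *)

theory Defs
  imports "HOL-Analysis.Analysis" "HOL-Computational_Algebra.Polynomial"
begin

definition exp_taylor :: "nat \<Rightarrow> real poly" where
  "exp_taylor n = (\<Sum>i=0..n. monom (1 / fact i) i)"

lemma poly_exp_taylor: "poly (exp_taylor n) y = (\<Sum>i=0..n. y ^ i / fact i)"
  by (simp add: exp_taylor_def poly_sum poly_monom)

definition sum_of_squares :: "real poly \<Rightarrow> bool" where
  "sum_of_squares p \<longleftrightarrow> (\<exists>qs :: real poly list. p = (\<Sum>q\<leftarrow>qs. q\<^sup>2))"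

end

theory Submission
  imports Defs "HOL-Computational_Algebra.Fundamental_Theorem_Algebra"
begin

text \<open>
  For negative \<open>y\<close> the Lagrange remainder of the Taylor polynomial of even order is an odd power
  of \<open>y\<close> with a positive coefficient, so the polynomial exceeds \<open>exp y\<close>.
  A nonnegative polynomial \<open>p\<close> on the real line is a sum of squares by induction on the degree:
  if \<open>p\<close> is not constant, it attains its minimum \<open>m \<ge> 0\<close> at some point \<open>a\<close>, which is a double
  root of \<open>p - m\<close>, so \<open>p = (x - a)\<^sup>2 q + m\<close> with \<open>q\<close> nonnegative of smaller degree.
\<close>

lemma sum_of_squares_add:
  assumes "sum_of_squares p" "sum_of_squares q"
  shows "sum_of_squares (p + q)"
proof -
  obtain ps qs :: "real poly list" where "p = (\<Sum>r\<leftarrow>ps. r\<^sup>2)" "q = (\<Sum>r\<leftarrow>qs. r\<^sup>2)"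
    using assms unfolding sum_of_squares_def by blast
  then have "p + q = (\<Sum>r\<leftarrow>ps @ qs. r\<^sup>2)"
    by simp
  then show ?thesis
    unfolding sum_of_squares_def by blast
qed

lemma sum_of_squares_square_mult:
  assumes "sum_of_squares p"
  shows "sum_of_squares (l\<^sup>2 * p)"
proof -
  obtain ps :: "real poly list" where "p = (\<Sum>r\<leftarrow>ps. r\<^sup>2)"
    using assms unfolding sum_of_squares_def by blast
  then have "l\<^sup>2 * p = (\<Sum>r\<leftarrow>map ((*) l) ps. r\<^sup>2)"
    by (simp add: sum_list_const_mult[symmetric] o_def power_mult_distrib)
  then show ?thesis
    unfolding sum_of_squares_def by blast
qed

lemma sum_of_squares_const:
  assumes "c \<ge> 0"
  shows "sum_of_squares [:c:]"
proof -
  have "[:c:] = (\<Sum>r\<leftarrow>[[:sqrt c:]]. r\<^sup>2)"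
    using assms by (simp add: power2_eq_square)
  then show ?thesis
    unfolding sum_of_squares_def by blast
qed

text \<open>A nonconstant polynomial tends to infinity in absolute value, so the minimum over a
  large compact interval is global.\<close>

lemma nonneg_poly_attains_min:
  fixes p :: "real poly"
  assumes nonneg: "\<And>x. poly p x \<ge> 0" and deg: "degree p > 0"
  obtains a where "\<And>x. poly p a \<le> poly p x"
proof -
  obtain c q where p: "p = pCons c q" and "q \<noteq> 0"
    using deg by (cases p) (auto split: if_splits)
  obtain r where r: "\<And>z. r \<le> \<bar>z\<bar> \<Longrightarrow> poly p 0 \<le> \<bar>poly p z\<bar>"
    using poly_infinity[OF \<open>q \<noteq> 0\<close>, of "poly p 0" c] unfolding p real_norm_def by blast
  \<comment> \<open>\<open>r\<close> may be negative; with \<open>\<bar>r\<bar>\<close> the interval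
    always contains 0, the point of comparison for all \<open>x\<close> outside.\<close>
  obtain a where a: "a \<in> {-\<bar>r\<bar>..\<bar>r\<bar>}" "\<forall>x\<in>{-\<bar>r\<bar>..\<bar>r\<bar>}. poly p a \<le> poly p x"
    using continuous_attains_inf[of "{-\<bar>r\<bar>..\<bar>r\<bar>}" "poly p"]
      continuous_on_poly[OF continuous_on_id, of _ p] by auto
  have "poly p a \<le> poly p x" for x
  proof (cases "x \<in> {-\<bar>r\<bar>..\<bar>r\<bar>}")
    case True
    then show ?thesis using a by blast
  next
    case False
    then have "poly p 0 \<le> poly p x"
      using r[of x] nonneg[of x] by auto
    moreover have "poly p a \<le> poly p 0"
      using a by auto
    ultimately show ?thesis by linarith
  qed
  then show thesis by (rule that)
qed

lemma nonneg_poly_root_factor: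
  fixes p :: "real poly"
  assumes nonneg: "\<And>x. poly p x \<ge> 0" and root: "poly p a = 0"
  obtains q where "p = [:-a, 1:]\<^sup>2 * q" "\<And>x. poly q x \<ge> 0"
proof -
  obtain u where u: "p = [:-a, 1:] * u"
    using root by (auto simp: poly_eq_0_iff_dvd elim: dvdE)
  \<comment> \<open>The root is a global minimum of \<open>p\<close>, so any radius works in the
    local test; 1 is arbitrary.\<close>
  have "poly (pderiv p) a = 0"
    using DERIV_local_min[OF poly_DERIV[of p a], of 1] nonneg root by simp
  \<comment> \<open>By the product rule, the derivative of \<open>(x - a) * u\<close> at
    \<open>a\<close> is \<open>u(a)\<close>.\<close>
  then have "poly u a = 0"
    unfolding u pderiv_mult by (simp add: pderiv_pCons)
  then obtain q where "u = [:-a, 1:] * q"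
    by (auto simp: poly_eq_0_iff_dvd elim: dvdE)
  then have p: "p = [:-a, 1:]\<^sup>2 * q"
    using u by (simp only: power2_eq_square mult.assoc)
  have off: "poly q x \<ge> 0" if "x \<noteq> a" for x
  proof -
    have "0 \<le> (x - a)\<^sup>2 * poly q x"
      using nonneg[of x] unfolding p poly_mult poly_power by simp
    moreover have "(x - a)\<^sup>2 > 0"
      using that by simp
    ultimately show ?thesis
      by (simp add: zero_le_mult_iff)
  qed
  \<comment> \<open>Dividing by \<open>(x - a)\<^sup>2\<close> says nothing at \<open>a\<close>
    itself; there the sign follows by continuity.\<close>
  have "(poly q \<longlongrightarrow> poly q a) (at a)"
    using poly_DERIV[of q a, THEN DERIV_isCont] by (simp add: isCont_def)
  then have "poly q a \<ge> 0"
    by (rule tendsto_lowerbound) (auto simp: eventually_at off intro: exI[of _ 1])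
  with off p that show thesis by metis
qed

theorem nonneg_poly_sum_of_squares:
  fixes p :: "real poly"
  assumes "\<And>x. poly p x \<ge> 0"
  shows "sum_of_squares p"
  using assms
proof (induction "degree p" arbitrary: p rule: less_induct)
  case less
  show ?case
  proof (cases "degree p = 0")
    case True
    then obtain c where "p = [:c:]"
      by (rule degree_eq_zeroE)
    then show ?thesis
      using less.prems[of 0] by (auto intro: sum_of_squares_const)
  next
    case False
    obtain a where a: "\<And>x. poly p a \<le> poly p x"
      using nonneg_poly_attains_min[of p] less.prems False by auto
    obtain q where q: "p - [:poly p a:] = [:-a, 1:]\<^sup>2 * q" "\<And>x. poly q x \<ge> 0"
      using nonneg_poly_root_factor[of "p - [:poly p a:]" a] a by auto
    have eq: "p = [:-a, 1:]\<^sup>2 * q + [:poly p a:]"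
      using q(1) by (simp add: algebra_simps)
    have "degree q < degree p"
    \<comment> \<open>Degrees add only for nonzero factors; for \<open>q = 0\<close> the convention
      \<open>degree 0 = 0\<close> suffices, as \<open>p\<close> is not constant.\<close>
    proof (cases "q = 0")
      case True
      then show ?thesis using False by simp
    next
      case False
      then have "degree ([:-a, 1:]\<^sup>2 * q) = 2 + degree q"
        by (simp add: degree_mult_eq degree_power_eq)
      then have "degree p = 2 + degree q"
        by (subst eq) (simp add: degree_add_eq_left)
      then show ?thesis by simp
    qed
    then have "sum_of_squares q"
      using less.hyps q(2) by blast
    then show ?thesis
      \<comment> \<open>The minimum value is itself nonnegative, hence a square.\<close>
      using less.prems[of a]
      by (subst eq) (intro sum_of_squares_add sum_of_squares_square_mult sum_of_squares_const)
  qed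
qed

lemma poly_exp_taylor_even_nonneg: "poly (exp_taylor (2 * s)) y \<ge> 0"
proof (cases "y \<ge> 0")
  case True
  then show ?thesis
    by (auto simp: poly_exp_taylor intro!: sum_nonneg)
next
  case False
  \<comment> \<open>Summing below \<open>2 * s + 1\<close> gives exactly the Taylor polynomial and
    leaves a remainder with an odd power of \<open>y\<close>, hence nonpositive here.\<close>
  let ?n = "Suc (2 * s)"
  obtain t where "exp y = (\<Sum>m<?n. y ^ m / fact m) + exp t / fact ?n * y ^ ?n"
    using Maclaurin_exp_le[of y ?n] by blast
  moreover have "exp t / fact ?n * y ^ ?n \<le> 0"
    using False by (intro mult_nonneg_nonpos) (auto simp: power_le_zero_eq simp del: power_Suc)
  moreover have "{..<?n} = {0..2 * s}"
    by auto
  ultimately have "exp y \<le> poly (exp_taylor (2 * s)) y"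
    by (simp add: poly_exp_taylor)
  then show ?thesis
    using exp_gt_zero[of y] by linarith
qed

theorem proposition2:
  fixes s :: nat
  assumes "s \<ge> 1"
  shows "(\<forall>y::real. poly (exp_taylor (2 * s)) y \<ge> 0) \<and> sum_of_squares (exp_taylor (2 * s))"
  using poly_exp_taylor_even_nonneg nonneg_poly_sum_of_squares by blast

end
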